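(* For $\ell>0$ let $\bar C_\ell$ be the circle of length $\ell$ with its intrinsic (arc-length) metric. Then its magnitude is \[|\bar C_\ell| = \frac{\ell/2}{1-e^{-\ell/2}}.\]
   Context: A weighting on a finite metric space $(W,d)$ is a choice of real number $w_x$ for each $x\in W$ such that $\sum_{x'\in W} e^{-d(x,x')}w_{x'}=1$ for every $x\in W$. If a weighting exists, the magnitude of $W$ is $|W| := \sum_{x\in W} w_x$; this is independent of the choice of weighting. A metric space $X$ is positive definite if for every finite subspace $W\subseteq X$ the matrix $(e^{-d(x,x')})_{x,x'\in W}$ is positive definite; finite positive definite spaces have a well-defined magnitude. The magnitude of a compact positive definite metric space $X$ is defined as $|X| := \sup\{|W| : W\subseteq X\text{ finite}\}$; equivalently (a result of Meckes), $|X|=\lim_{k}|X_k|$ for any sequence $(X_k)$ of finite subsets of $X$ converging to $X$ in the Hausdorff metric. In $\bar C_\ell$ the distance between two points subtending an angle $\theta\in[0,\pi]$ at the centre is $\ell\theta/2\pi$ (the length of the shorter arc between them). The space $\bar C_\ell$ is compact and positive definite (a known result of Meckes). *)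

theory Defs
  imports "HOL-Analysis.Analysis"
begin

definition weighting_on :: "'a set \<Rightarrow> ('a \<Rightarrow> 'a \<Rightarrow> real) \<Rightarrow> ('a \<Rightarrow> real) \<Rightarrow> bool" where
  "weighting_on W d w \<longleftrightarrow> (\<forall>x\<in>W. (\<Sum>x'\<in>W. exp (- d x x') * w x') = 1)"

definition finite_magnitude :: "'a set \<Rightarrow> ('a \<Rightarrow> 'a \<Rightarrow> real) \<Rightarrow> real" where
  "finite_magnitude W d = (THE m. \<exists>w. weighting_on W d w \<and> m = (\<Sum>x\<in>W. w x))"

lemma weighting_sum_unique:
  assumes "weighting_on W d w" "weighting_on W d v"
    and sym: "\<And>x y. x \<in> W \<Longrightarrow> y \<in> W \<Longrightarrow> d x y = d y x"
  shows "sum w W = sum v W"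
proof -
  have "sum w W = (\<Sum>x\<in>W. w x * (\<Sum>y\<in>W. exp (- d x y) * v y))"
    using assms(2) by (intro sum.cong) (auto simp: weighting_on_def)
  also have "\<dots> = (\<Sum>x\<in>W. \<Sum>y\<in>W. w x * (exp (- d x y) * v y))"
    by (simp add: sum_distrib_left)
  also have "\<dots> = (\<Sum>y\<in>W. \<Sum>x\<in>W. w x * (exp (- d x y) * v y))"
    by (rule sum.swap)
  also have "\<dots> = (\<Sum>y\<in>W. \<Sum>x\<in>W. v y * (exp (- d y x) * w x))"
    by (intro sum.cong refl) (simp add: sym mult_ac)
  also have "\<dots> = (\<Sum>y\<in>W. v y * (\<Sum>x\<in>W. exp (- d y x) * w x))"
    by (simp add: sum_distrib_left)
  also have "\<dots> = sum v W"
    using assms(1) by (intro sum.cong) (auto simp: weighting_on_def)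
  finally show ?thesis .
qed

lemma finite_magnitude_eq:
  assumes "weighting_on W d w"
    and sym: "\<And>x y. x \<in> W \<Longrightarrow> y \<in> W \<Longrightarrow> d x y = d y x"
  shows "finite_magnitude W d = sum w W"
  unfolding finite_magnitude_def
proof (rule the_equality)
  show "\<exists>v. weighting_on W d v \<and> sum w W = sum v W"
    using assms(1) by blast
next
  fix m assume "\<exists>v. weighting_on W d v \<and> m = sum v W"
  then obtain v where "weighting_on W d v" "m = sum v W" by blast
  then show "m = sum w W"
    using weighting_sum_unique[of W d v w] assms(1) sym by metis
qed

(* Meant for compact positive definite (X, d), where every finite subset has a weighting.
   The supremum is taken in the extended reals because the supremum of an unbounded set
   of reals is unspecified. *)
definition magnitude :: "'a set \<Rightarrow> ('a \<Rightarrow> 'a \<Rightarrow> real) \<Rightarrow> ereal" where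
  "magnitude X d = (SUP W\<in>{W. finite W \<and> W \<subseteq> X}. ereal (finite_magnitude W d))"

definition circle :: "real \<Rightarrow> complex set" where
  "circle l = sphere 0 (l / (2 * pi))"

(* The arccos term is the angle in [0, pi] that x and y subtend at the centre 0. *)
definition arc_dist :: "real \<Rightarrow> complex \<Rightarrow> complex \<Rightarrow> real" where
  "arc_dist l x y = l * arccos ((x \<bullet> y) / (norm x * norm y)) / (2 * pi)"

lemma arc_dist_commute: "arc_dist l x y = arc_dist l y x"
  by (simp add: arc_dist_def inner_commute mult.commute)

lemma arc_dist_rcis:
  assumes "r > 0" "\<bar>a - b\<bar> \<le> pi"
  shows "arc_dist l (rcis r a) (rcis r b) = l * \<bar>a - b\<bar> / (2 * pi)"
proof -
  have "rcis r a \<bullet> rcis r b = r * r * cos (a - b)"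
    by (simp add: inner_complex_def cos_diff algebra_simps)
  then have "(rcis r a \<bullet> rcis r b) / (norm (rcis r a) * norm (rcis r b)) = cos (a - b)"
    using assms(1) by (simp add: norm_mult rcis_def)
  moreover have "arccos (cos (a - b)) = \<bar>a - b\<bar>"
    using assms(2) by (metis abs_ge_zero arccos_cos cos_abs_real)
  ultimately show ?thesis by (simp add: arc_dist_def)
qed

end

(* Write q = exp (- l/2) and M = (l/2) / (1 - q).  On the circle,
   exp (- d s t) = P s t - q * P s (T t), where P is the l-periodisation of exp (- |s - t|)
   and T the antipodal map.  P is the autocorrelation of the periodised one-sided exponential,
   so P minus its mean 2/l is positive semidefinite, and T is an involution preserving P.
   Hence the quadratic form of exp (- d) satisfies Q v >= (sum v)^2 / M on every finite subset.
   This makes the all-ones vector orthogonal to the kernel of Q, so that a weighting w exists,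
   and Q w = sum w then gives sum w <= M.  Regular polygons with 2m vertices, which have
   constant weightings, show that the bound M is approached. *)

theory Submission
  imports Defs "HOL-Real_Asymp.Real_Asymp"
begin

section \<open>Solvability of semidefinite linear systems\<close>

text \<open>The null vectors of a semidefinite form make up the kernel of its matrix, so the last
  hypothesis is the Fredholm condition that \<open>b\<close> is orthogonal to the kernel. The
  induction is Gaussian elimination: the system on \<open>W\<close> is solved both for
  \<open>b\<close> and for the column of \<open>K\<close> at the new index \<open>x\<close>, and the
  two solutions are combined.\<close>

lemma psd_system_solvable:
  fixes K :: "'a \<Rightarrow> 'a \<Rightarrow> real"
  assumes "finite W"
    and "\<And>x y. x \<in> W \<Longrightarrow> y \<in> W \<Longrightarrow> K x y = K y x"
    and "\<And>v. 0 \<le> (\<Sum>x\<in>W. v x * (\<Sum>y\<in>W. K x y * v y))"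
    and "\<And>v. (\<Sum>x\<in>W. v x * (\<Sum>y\<in>W. K x y * v y)) = 0 \<Longrightarrow> (\<Sum>x\<in>W. b x * v x) = 0"
  shows "\<exists>w. \<forall>x\<in>W. (\<Sum>y\<in>W. K x y * w y) = b x"
  using assms
proof (induction W arbitrary: b rule: finite_induct)
  case empty
  then show ?case by simp
next
  case (insert x W)
  let ?Q = "\<lambda>v. \<Sum>x\<in>W. v x * (\<Sum>y\<in>W. K x y * v y)"
  have sum_upd: "(\<Sum>y\<in>W. f y * (v(x := c)) y) = (\<Sum>y\<in>W. f y * v y)" for f v and c :: real
    using insert.hyps by (intro sum.cong) auto
  have Q_insert: "(\<Sum>z\<in>insert x W. (v(x := c)) z * (\<Sum>y\<in>insert x W. K z y * (v(x := c)) y))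
      = ?Q v + 2 * c * (\<Sum>y\<in>W. K x y * v y) + c\<^sup>2 * K x x" for v c
  proof -
    have row: "(\<Sum>y\<in>insert x W. K z y * (v(x := c)) y) = K z x * c + (\<Sum>y\<in>W. K z y * v y)" for z
      using insert.hyps by (simp add: sum_upd del: fun_upd_apply) simp
    have "(\<Sum>z\<in>W. (v(x := c)) z * (K z x * c + (\<Sum>y\<in>W. K z y * v y)))
        = (\<Sum>z\<in>W. c * (K x z * v z) + v z * (\<Sum>y\<in>W. K z y * v y))"
      using insert.hyps insert.prems(1) by (intro sum.cong) (auto simp: algebra_simps)
    also have "\<dots> = c * (\<Sum>y\<in>W. K x y * v y) + ?Q v"
      by (simp add: sum.distrib sum_distrib_left)
    finally show ?thesis
      unfolding row sum.insert[OF insert.hyps] by (simp add: algebra_simps power2_eq_square)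
  qed
  have psd: "0 \<le> ?Q v + 2 * c * (\<Sum>y\<in>W. K x y * v y) + c\<^sup>2 * K x x" for v c
    using insert.prems(2)[of "v(x := c)"] unfolding Q_insert .
  have psd_W: "0 \<le> ?Q v" for v
    using psd[of v 0] by simp
  have b_W: "(\<Sum>y\<in>W. b y * v y) = 0" if "?Q v = 0" for v
    using insert.prems(3)[of "v(x := 0)"] insert.hyps that by (simp only: Q_insert) (simp add: sum_upd del: fun_upd_apply, simp)
  \<comment> \<open>The column at \<open>x\<close> satisfies the Fredholm condition on
    \<open>W\<close>: for a null vector \<open>v\<close> the form at \<open>v(x := c)\<close> is
    \<open>2 * c * k\<close> plus a multiple of \<open>c\<^sup>2\<close>, which is nonnegative for
    all \<open>c\<close> only if \<open>k = 0\<close>.\<close>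
  have K_W: "(\<Sum>y\<in>W. K x y * v y) = 0" if "?Q v = 0" for v
  proof (rule ccontr)
    define k where "k = (\<Sum>y\<in>W. K x y * v y)"
    assume "(\<Sum>y\<in>W. K x y * v y) \<noteq> 0"
    then have "k \<noteq> 0" by (simp add: k_def)
    have le: "0 \<le> 2 * c * k + c\<^sup>2 * K x x" for c
      using psd[of v c] that by (simp add: k_def)
    \<comment> \<open>A positive number above \<open>K x x\<close>, so that
      \<open>c = - k / a\<close> makes the value negative even when
      \<open>K x x = 0\<close>.\<close>
    define a where "a = \<bar>K x x\<bar> + 1"
    have "a > 0" "K x x < a" by (auto simp: a_def)
    have "2 * (- k / a) * k + (- k / a)\<^sup>2 * K x x = (k\<^sup>2 / a) * (K x x / a - 2)"
      by (simp add: power2_eq_square algebra_simps)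
    moreover have "k\<^sup>2 / a > 0" "K x x / a - 2 < 0"
      using \<open>k \<noteq> 0\<close> \<open>a > 0\<close> \<open>K x x < a\<close> by (auto simp: field_simps)
    ultimately show False
      using le[of "- k / a"] mult_pos_neg[of "k\<^sup>2 / a" "K x x / a - 2"] by linarith
  qed
  have sym_W: "K y z = K z y" if "y \<in> W" "z \<in> W" for y z
    using that insert.prems(1) by blast
  obtain u where u: "\<And>y. y \<in> W \<Longrightarrow> (\<Sum>z\<in>W. K y z * u z) = K x y"
    using insert.IH[OF sym_W psd_W K_W] by blast
  obtain w where w: "\<And>y. y \<in> W \<Longrightarrow> (\<Sum>z\<in>W. K y z * w z) = b y"
    using insert.IH[OF sym_W psd_W b_W] by blast
  \<comment> \<open>\<open>s\<close> is the Schur complement, that is, the pivot at \<open>x\<close>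
    after eliminating \<open>W\<close>; \<open>r\<close> is the residual of \<open>w\<close> in row
    \<open>x\<close>. Any \<open>c\<close> with \<open>c * s = r\<close> completes the
    solution.\<close>
  define s where "s = K x x - (\<Sum>y\<in>W. K x y * u y)"
  define r where "r = b x - (\<Sum>y\<in>W. K x y * w y)"
  have r0: "r = 0" if "s = 0"
  proof -
    \<comment> \<open>The form takes the value \<open>s\<close> at the vector \<open>- u\<close>
      extended by 1 at \<open>x\<close>. If \<open>s = 0\<close>, this is a null vector, so
      \<open>b\<close> is orthogonal to it, and symmetry of \<open>K\<close> turns that into
      \<open>r = 0\<close>.\<close>
    have "?Q (\<lambda>y. - u y) + 2 * 1 * (\<Sum>y\<in>W. K x y * - u y) + 1\<^sup>2 * K x x = s"
      by (simp add: s_def u sum_negf) (simp add: mult.commute)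
    then have "(\<Sum>z\<in>insert x W. b z * ((\<lambda>y. - u y)(x := 1)) z) = 0"
      using that by (intro insert.prems(3)) (simp only: Q_insert)
    then have "b x = (\<Sum>z\<in>W. b z * u z)"
      using insert.hyps by (simp add: sum_upd del: fun_upd_apply) (simp add: sum_negf)
    also have "\<dots> = (\<Sum>z\<in>W. \<Sum>y\<in>W. K z y * w y * u z)"
      by (simp add: w sum_distrib_right[symmetric])
    also have "\<dots> = (\<Sum>y\<in>W. \<Sum>z\<in>W. K y z * u z * w y)"
      by (subst sum.swap, intro sum.cong) (auto simp: sym_W)
    also have "\<dots> = (\<Sum>y\<in>W. K x y * w y)"
      by (simp add: u sum_distrib_right[symmetric])
    finally show ?thesis by (simp add: r_def)
  qed
  \<comment> \<open>If \<open>s = 0\<close>, division by zero gives \<open>c = 0\<close>, which is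
    consistent because then \<open>r = 0\<close>.\<close>
  define c where "c = r / s"
  have rs: "c * s = r" using r0 by (cases "s = 0") (simp_all add: c_def)
  define w' where "w' = (\<lambda>y. w y - c * u y)(x := c)"
  have row: "(\<Sum>y\<in>insert x W. K z y * w' y)
      = K z x * c + (\<Sum>y\<in>W. K z y * w y) - c * (\<Sum>y\<in>W. K z y * u y)" for z
    using insert.hyps unfolding w'_def
    by (simp add: sum_upd del: fun_upd_apply)
       (simp add: right_diff_distrib sum_subtractf sum_distrib_left mult.left_commute)
  have "(\<Sum>y\<in>insert x W. K z y * w' y) = b z" if "z \<in> insert x W" for z
  proof (cases "z = x")
    case True
    have "(\<Sum>y\<in>insert x W. K x y * w' y) = c * s + (\<Sum>y\<in>W. K x y * w y)"
      unfolding row s_def by (simp add: algebra_simps)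
    then show ?thesis
      using rs True by (simp add: r_def)
  next
    case False
    then show ?thesis
      using that insert.prems(1)[of x z] by (simp only: row) (simp add: u w)
  qed
  then show ?case by blast
qed

section \<open>The periodised one-sided exponential and its autocorrelation\<close>

text \<open>On \<open>[0, l]\<close>, up to the factor \<open>1 - exp (- l)\<close>, this is the
  \<open>l\<close>-periodisation in \<open>u\<close> of the function that is
  \<open>exp (u - s)\<close> for \<open>u \<le> s\<close> and 0 afterwards.\<close>

definition saw_exp :: "real \<Rightarrow> real \<Rightarrow> real \<Rightarrow> real" where
  "saw_exp l s u = (if u \<le> s then exp (u - s) else exp (u - s - l))"

lemma has_integral_exp_affine:
  fixes a b c k :: real
  assumes "a \<le> b" "k \<noteq> 0"
  shows "((\<lambda>u. exp (k * u - c)) has_integral (exp (k * b - c) - exp (k * a - c)) / k) {a..b}"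
proof -
  have "((\<lambda>u. exp (k * u - c)) has_integral exp (k * b - c) / k - exp (k * a - c) / k) {a..b}"
    using assms
    by (intro fundamental_theorem_of_calculus)
       (auto intro!: derivative_eq_intros simp: has_real_derivative_iff_has_vector_derivative[symmetric])
  then show ?thesis by (simp add: diff_divide_distrib)
qed

lemma has_integral_saw_exp:
  assumes "0 \<le> s" "s \<le> l"
  shows "(saw_exp l s has_integral 1 - exp (- l)) {0..l}"
proof -
  have "(saw_exp l s has_integral (exp (1 * s - s) - exp (1 * 0 - s)) / 1) {0..s}"
    by (rule has_integral_eq[OF _ has_integral_exp_affine]) (use assms in \<open>auto simp: saw_exp_def\<close>)
  \<comment> \<open>At \<open>u = s\<close> the other branch of \<open>saw_exp\<close> applies; this
    single point is discarded as a null set.\<close>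
  moreover have "(saw_exp l s has_integral (exp (1 * l - (s + l)) - exp (1 * s - (s + l))) / 1) {s..l}"
    by (rule has_integral_spike_finite[OF _ _ has_integral_exp_affine, of "{s}"])
       (use assms in \<open>auto simp: saw_exp_def algebra_simps\<close>)
  ultimately show ?thesis
    using has_integral_combine[OF assms] by fastforce
qed

text \<open>This exhibits the periodised two-sided exponential as a Gram kernel. By symmetry
  \<open>s \<le> t\<close>, and on each of \<open>[0, s]\<close>, \<open>[s, t]\<close> and
  \<open>[t, l]\<close> the product is a single exponential in \<open>2 * u\<close>.\<close>

lemma has_integral_saw_exp_mult:
  assumes "0 \<le> s" "s \<le> l" "0 \<le> t" "t \<le> l"
  shows "((\<lambda>u. saw_exp l s u * saw_exp l t u) has_integral
    (1 - exp (- l)) * (exp (- \<bar>s - t\<bar>) + exp (\<bar>s - t\<bar> - l)) / 2) {0..l}"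
  using assms
proof (induction s t rule: linorder_wlog)
  case (le s t)
  let ?f = "\<lambda>u. saw_exp l s u * saw_exp l t u"
  have "(?f has_integral (exp (2 * s - (s + t)) - exp (2 * 0 - (s + t))) / 2) {0..s}"
    by (rule has_integral_eq[OF _ has_integral_exp_affine])
       (use le in \<open>auto simp: saw_exp_def exp_add[symmetric]\<close>)
  moreover have "(?f has_integral (exp (2 * t - (s + t + l)) - exp (2 * s - (s + t + l))) / 2) {s..t}"
    by (rule has_integral_spike_finite[OF _ _ has_integral_exp_affine, of "{s}"])
       (use le in \<open>auto simp: saw_exp_def exp_add[symmetric] algebra_simps\<close>)
  ultimately have "(?f has_integral (exp (2 * s - (s + t)) - exp (2 * 0 - (s + t))) / 2
      + (exp (2 * t - (s + t + l)) - exp (2 * s - (s + t + l))) / 2) {0..t}"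
    using le by (intro has_integral_combine[of 0 s t]) auto
  moreover have "(?f has_integral (exp (2 * l - (s + t + 2 * l)) - exp (2 * t - (s + t + 2 * l))) / 2) {t..l}"
    by (rule has_integral_spike_finite[OF _ _ has_integral_exp_affine, of "{t}"])
       (use le in \<open>auto simp: saw_exp_def exp_add[symmetric] algebra_simps\<close>)
  ultimately have "(?f has_integral (exp (2 * s - (s + t)) - exp (2 * 0 - (s + t))) / 2
      + (exp (2 * t - (s + t + l)) - exp (2 * s - (s + t + l))) / 2
      + (exp (2 * l - (s + t + 2 * l)) - exp (2 * t - (s + t + 2 * l))) / 2) {0..l}"
    using le by (intro has_integral_combine[of 0 t l]) auto
  moreover have "(exp (2 * s - (s + t)) - exp (2 * 0 - (s + t))) / 2
      + (exp (2 * t - (s + t + l)) - exp (2 * s - (s + t + l))) / 2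
      + (exp (2 * l - (s + t + 2 * l)) - exp (2 * t - (s + t + 2 * l))) / 2
      = (1 - exp (- l)) * (exp (- \<bar>s - t\<bar>) + exp (\<bar>s - t\<bar> - l)) / 2"
    using le by (simp add: algebra_simps exp_add[symmetric] add_divide_distrib diff_divide_distrib)
  ultimately show ?case by (simp only:)
next
  case (sym s t)
  then show ?case by (simp add: mult.commute abs_minus_commute)
qed


section \<open>The arc-length kernel and its quadratic form\<close>

text \<open>Points of the circle of length \<open>l\<close> are parametrised by arc length in \<open>[0, l)\<close>. The kernel
  \<open>periodic_exp\<close> is the periodisation of \<open>exp (- \<bar>s - t\<bar>)\<close> up to the factor \<open>1 - exp (- l)\<close>.\<close>

definition antipode :: "real \<Rightarrow> real \<Rightarrow> real" where
  "antipode l t = (if t < l / 2 then t + l / 2 else t - l / 2)"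

definition cyclic_dist :: "real \<Rightarrow> real \<Rightarrow> real \<Rightarrow> real" where
  "cyclic_dist l s t = min \<bar>s - t\<bar> (l - \<bar>s - t\<bar>)"

definition periodic_exp :: "real \<Rightarrow> real \<Rightarrow> real \<Rightarrow> real" where
  "periodic_exp l s t = exp (- \<bar>s - t\<bar>) + exp (\<bar>s - t\<bar> - l)"

text \<open>\<open>periodic_exp\<close> is unchanged when \<open>\<bar>s - t\<bar>\<close> is
  replaced by \<open>l - \<bar>s - t\<bar>\<close>, so it depends only on the distance around the
  circle. The antipodal map is a half turn, hence an isometry and its own inverse.\<close>

lemma periodic_exp_antipode:
  assumes "0 \<le> s" "s < l" "0 \<le> t" "t < l"
  shows "periodic_exp l (antipode l s) (antipode l t) = periodic_exp l s t"
    and "periodic_exp l (antipode l s) t = periodic_exp l s (antipode l t)"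
proof -
  have eq: "periodic_exp l x y = periodic_exp l x' y'"
    if "\<bar>x - y\<bar> = \<bar>x' - y'\<bar> \<or> \<bar>x - y\<bar> = l - \<bar>x' - y'\<bar>" for x y x' y'
    using that by (auto simp: periodic_exp_def)
  show "periodic_exp l (antipode l s) (antipode l t) = periodic_exp l s t"
    using assms by (intro eq) (auto simp: antipode_def abs_if)
  show "periodic_exp l (antipode l s) t = periodic_exp l s (antipode l t)"
    using assms by (intro eq) (auto simp: antipode_def abs_if)
qed

text \<open>With \<open>d\<close> the cyclic distance, the antipode of \<open>t\<close> lies at
  distance \<open>l / 2 - d\<close> from \<open>s\<close>. The subtracted term is therefore
  \<open>exp (d - l) + exp (- d - l)\<close>, which cancels the contribution
  \<open>exp (d - l)\<close> of the longer arc.\<close>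

lemma exp_cyclic_dist:
  assumes "0 \<le> s" "s < l" "0 \<le> t" "t < l"
  shows "(1 - exp (- l)) * exp (- cyclic_dist l s t)
    = periodic_exp l s t - exp (- (l / 2)) * periodic_exp l s (antipode l t)"
proof -
  consider "s = t + l / 2" | "t = s + l / 2" | "s \<noteq> t + l / 2" "t \<noteq> s + l / 2" by blast
  then show ?thesis
    using assms unfolding periodic_exp_def antipode_def cyclic_dist_def
    by cases (auto simp: abs_if min_def algebra_simps exp_add[symmetric])
qed

text \<open>The subtracted constant is the mean of \<open>saw_exp l s\<close> over
  \<open>[0, l]\<close>.\<close>

definition centred_saw :: "real \<Rightarrow> real \<Rightarrow> real \<Rightarrow> real" where
  "centred_saw l s u = saw_exp l s u - (1 - exp (- l)) / l"

lemma has_integral_centred_saw_mult: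
  assumes "l > 0" "0 \<le> s" "s < l" "0 \<le> t" "t < l"
  shows "((\<lambda>u. centred_saw l s u * centred_saw l t u) has_integral
    (1 - exp (- l)) * periodic_exp l s t / 2 - (1 - exp (- l))\<^sup>2 / l) {0..l}"
proof -
  define m where "m = (1 - exp (- l)) / l"
  have c: "((\<lambda>u. m * m) has_integral l * (m * m)) {0..l}"
    using has_integral_const_real[of "m * m" 0 l] assms(1) by simp
  have int: "((\<lambda>u. saw_exp l s u * saw_exp l t u - m * saw_exp l s u - m * saw_exp l t u + m * m)
    has_integral (1 - exp (- l)) * periodic_exp l s t / 2 - m * (1 - exp (- l))
      - m * (1 - exp (- l)) + l * (m * m)) {0..l}"
    unfolding periodic_exp_def
    using assms c
    by (intro has_integral_add has_integral_diff has_integral_mult_right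
          has_integral_saw_exp_mult has_integral_saw_exp) auto
  have "l * (m * m) - m * (1 - exp (- l)) - m * (1 - exp (- l)) = - ((1 - exp (- l))\<^sup>2 / l)"
    using assms(1) by (simp add: m_def field_simps power2_eq_square)
  then show ?thesis
    unfolding centred_saw_def m_def[symmetric]
    by (intro has_integral_eq_rhs[OF has_integral_eq[OF _ int]]) (auto simp: algebra_simps)
qed

text \<open>The integrand is a combination of products \<open>f s u * f t u\<close> with nonnegative coefficients, so the
  right-hand side is a positive semidefinite kernel in \<open>s\<close> and \<open>t\<close>.\<close>

lemma has_integral_cyclic_kernel:
  assumes "l > 0" "0 \<le> s" "s < l" "0 \<le> t" "t < l"
  defines "q \<equiv> exp (- (l / 2))"
  shows "((\<lambda>u. (1 - q) * (centred_saw l s u * centred_saw l t u)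
      + q / 2 * ((centred_saw l s u - centred_saw l (antipode l s) u)
               * (centred_saw l t u - centred_saw l (antipode l t) u)))
    has_integral (1 - exp (- l))\<^sup>2 / 2 * (exp (- cyclic_dist l s t) - 2 * (1 - q) / l)) {0..l}"
proof -
  define A where "A x y = (1 - exp (- l)) * periodic_exp l x y / 2 - (1 - exp (- l))\<^sup>2 / l" for x y
  have A_T: "A (antipode l s) (antipode l t) = A s t" "A (antipode l s) t = A s (antipode l t)"
    using periodic_exp_antipode[OF assms(2-5)] by (auto simp: A_def)
  have T: "0 \<le> antipode l x \<and> antipode l x < l" if "0 \<le> x" "x < l" for x
    using that assms(1) by (auto simp: antipode_def)
  have A: "((\<lambda>u. centred_saw l x u * centred_saw l y u) has_integral A x y) {0..l}"
    if "0 \<le> x \<and> x < l" "0 \<le> y \<and> y < l" for x y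
    unfolding A_def using that assms(1) by (intro has_integral_centred_saw_mult) auto
  let ?g = "centred_saw l"
  have "((\<lambda>u. (1 - q) * (?g s u * ?g t u) + q / 2 *
      (?g s u * ?g t u - ?g s u * ?g (antipode l t) u
        - ?g (antipode l s) u * ?g t u + ?g (antipode l s) u * ?g (antipode l t) u))
    has_integral (1 - q) * A s t + q / 2 *
      (A s t - A s (antipode l t) - A (antipode l s) t + A (antipode l s) (antipode l t))) {0..l}"
    using assms T by (intro has_integral_add has_integral_diff has_integral_mult_right A) auto
  \<comment> \<open>By antipodal invariance the bracket is
    \<open>2 * (A s t - A s (antipode l t))\<close>. The weights \<open>1 - q\<close> and
    \<open>q / 2\<close> are chosen to give the combination from \<open>exp_cyclic_dist\<close>
    while staying nonnegative.\<close>
  moreover have "(1 - q) * A s t + q / 2 *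
      (A s t - A s (antipode l t) - A (antipode l s) t + A (antipode l s) (antipode l t))
      = A s t - q * A s (antipode l t)"
    unfolding A_T by (simp add: algebra_simps)
  \<comment> \<open>The constant removed by centring occurs in both terms, so it survives with the
    factor \<open>1 - q\<close>; this is the source of \<open>2 * (1 - q) / l\<close>, the
    reciprocal of the magnitude.\<close>
  moreover have "A s t - q * A s (antipode l t)
      = (1 - exp (- l)) / 2 * (periodic_exp l s t - q * periodic_exp l s (antipode l t))
        - (1 - q) * (1 - exp (- l))\<^sup>2 / l"
    by (simp add: A_def algebra_simps diff_divide_distrib)
  moreover have "\<dots> = (1 - exp (- l))\<^sup>2 / 2 * (exp (- cyclic_dist l s t) - 2 * (1 - q) / l)"
    unfolding q_def exp_cyclic_dist[OF assms(2-5), symmetric] using assms(1)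
    by (simp add: field_simps power2_eq_square)
  ultimately have "((\<lambda>u. (1 - q) * (?g s u * ?g t u) + q / 2 *
      (?g s u * ?g t u - ?g s u * ?g (antipode l t) u
        - ?g (antipode l s) u * ?g t u + ?g (antipode l s) u * ?g (antipode l t) u))
     has_integral (1 - exp (- l))\<^sup>2 / 2 * (exp (- cyclic_dist l s t) - 2 * (1 - q) / l)) {0..l}"
    by (simp only:)
  then show ?thesis
    by (rule has_integral_eq[rotated]) (simp add: algebra_simps)
qed

text \<open>Summing the kernel identity against \<open>v x * v y\<close> makes the integrand a
  nonnegative combination of two squares at each \<open>u\<close>, so the integral, a positive
  multiple of the difference of the two sides, is nonnegative.\<close>

lemma cyclic_form_lower_bound:
  fixes t v :: "'a \<Rightarrow> real"
  assumes "l > 0" "finite W" and t: "\<And>x. x \<in> W \<Longrightarrow> 0 \<le> t x \<and> t x < l"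
  shows "2 * (1 - exp (- (l / 2))) / l * (sum v W)\<^sup>2
    \<le> (\<Sum>x\<in>W. v x * (\<Sum>y\<in>W. exp (- cyclic_dist l (t x) (t y)) * v y))"
proof -
  define q where "q = exp (- (l / 2))"
  define g where "g x = centred_saw l (t x)" for x
  define h where "h x u = g x u - centred_saw l (antipode l (t x)) u" for x u
  define c where "c = (1 - exp (- l))\<^sup>2 / 2"
  define k where "k = 2 * (1 - q) / l"
  have "c > 0" "0 < q" "q < 1" using assms(1) by (auto simp: c_def q_def)
  have "((\<lambda>u. \<Sum>x\<in>W. \<Sum>y\<in>W. v x * v y * ((1 - q) * (g x u * g y u) + q / 2 * (h x u * h y u)))
    has_integral (\<Sum>x\<in>W. \<Sum>y\<in>W. v x * v y *
      (c * (exp (- cyclic_dist l (t x) (t y)) - 2 * (1 - q) / l)))) {0..l}"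
    unfolding g_def h_def q_def c_def using assms
    by (intro has_integral_sum has_integral_mult_right has_integral_cyclic_kernel) auto
  then have "0 \<le> (\<Sum>x\<in>W. \<Sum>y\<in>W. v x * v y *
      (c * (exp (- cyclic_dist l (t x) (t y)) - 2 * (1 - q) / l)))"
  proof (rule has_integral_nonneg)
    fix u
    have "(\<Sum>x\<in>W. \<Sum>y\<in>W. v x * v y * ((1 - q) * (g x u * g y u) + q / 2 * (h x u * h y u)))
      = (1 - q) * (\<Sum>x\<in>W. v x * g x u)\<^sup>2 + q / 2 * (\<Sum>x\<in>W. v x * h x u)\<^sup>2"
      by (simp add: power2_eq_square sum_product sum_distrib_left sum.distrib sum_subtractf algebra_simps)
    also have "\<dots> \<ge> 0"
      using \<open>0 < q\<close> \<open>q < 1\<close> by simp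
    finally show "0 \<le> (\<Sum>x\<in>W. \<Sum>y\<in>W. v x * v y * ((1 - q) * (g x u * g y u) + q / 2 * (h x u * h y u)))" .
  qed
  also have "\<dots> = c * ((\<Sum>x\<in>W. v x * (\<Sum>y\<in>W. exp (- cyclic_dist l (t x) (t y)) * v y))
      - 2 * (1 - q) / l * (sum v W)\<^sup>2)"
    unfolding k_def[symmetric]
    by (simp add: power2_eq_square sum_product sum_distrib_left sum_subtractf algebra_simps)
  finally show ?thesis
    using \<open>c > 0\<close> by (simp add: zero_le_mult_iff q_def)
qed

section \<open>Transfer to the circle in the plane and the upper bound\<close>

lemma arc_dist_rcis_cyclic:
  assumes "l > 0" "r > 0" "0 \<le> a" "a < 2 * pi" "0 \<le> b" "b < 2 * pi"
  shows "arc_dist l (rcis r a) (rcis r b) = cyclic_dist l (l * a / (2 * pi)) (l * b / (2 * pi))"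
proof -
  have period: "rcis r (x - 2 * pi) = rcis r x" for x
    by (simp add: complex_eq_iff cos_diff sin_diff)
  have scale: "\<bar>l * a / (2 * pi) - l * b / (2 * pi)\<bar> = l * \<bar>a - b\<bar> / (2 * pi)"
    using assms(1) by (simp add: diff_divide_distrib[symmetric] right_diff_distrib[symmetric] abs_mult)
  have le_iff: "l * \<bar>a - b\<bar> / (2 * pi) \<le> l - l * \<bar>a - b\<bar> / (2 * pi) \<longleftrightarrow> \<bar>a - b\<bar> \<le> pi"
    using assms(1) by (simp add: field_simps)
  \<comment> \<open>If the angles differ by more than \<open>pi\<close>, the larger one is lowered
    by a full turn; the gap becomes \<open>2 * pi - \<bar>a - b\<bar>\<close>, where
    \<open>arc_dist_rcis\<close> applies.\<close>
  consider "\<bar>a - b\<bar> \<le> pi" | "a - b > pi" | "b - a > pi" by linarith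
  then show ?thesis
  proof cases
    case 1
    then show ?thesis
      using arc_dist_rcis[OF assms(2) 1] le_iff by (simp add: cyclic_dist_def scale)
  next
    case 2
    then have far: "\<not> \<bar>a - b\<bar> \<le> pi" by linarith
    have "arc_dist l (rcis r (a - 2 * pi)) (rcis r b) = l * \<bar>a - 2 * pi - b\<bar> / (2 * pi)"
      using 2 assms by (intro arc_dist_rcis) auto
    also have "\<bar>a - 2 * pi - b\<bar> = 2 * pi - \<bar>a - b\<bar>"
      using 2 assms pi_gt_zero by linarith
    finally show ?thesis
      using assms(1) unfolding period cyclic_dist_def scale min_def le_iff if_not_P[OF far]
      by (simp add: field_simps)
  next
    case 3
    then have far: "\<not> \<bar>a - b\<bar> \<le> pi" by linarith
    have "arc_dist l (rcis r a) (rcis r (b - 2 * pi)) = l * \<bar>a - (b - 2 * pi)\<bar> / (2 * pi)"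
      using 3 assms by (intro arc_dist_rcis) auto
    also have "\<bar>a - (b - 2 * pi)\<bar> = 2 * pi - \<bar>a - b\<bar>"
      using 3 assms pi_gt_zero by linarith
    finally show ?thesis
      using assms(1) unfolding period cyclic_dist_def scale min_def le_iff if_not_P[OF far]
      by (simp add: field_simps)
  qed
qed

lemma circle_form_lower_bound:
  assumes "l > 0" "finite W" "W \<subseteq> circle l"
  shows "2 * (1 - exp (- (l / 2))) / l * (sum v W)\<^sup>2
    \<le> (\<Sum>x\<in>W. v x * (\<Sum>y\<in>W. exp (- arc_dist l x y) * v y))"
proof -
  define t where "t x = l * Arg2pi x / (2 * pi)" for x
  have polar: "x = rcis (l / (2 * pi)) (Arg2pi x)" if "x \<in> W" for x
    using that assms(3) Arg2pi_eq[of x]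
    by (auto simp: circle_def rcis_def cis_conv_exp)
  have "arc_dist l x y = cyclic_dist l (t x) (t y)" if "x \<in> W" "y \<in> W" for x y
    using arc_dist_rcis_cyclic[of l "l / (2 * pi)" "Arg2pi x" "Arg2pi y"] polar that assms(1)
      Arg2pi_ge_0 Arg2pi_lt_2pi by (auto simp: t_def)
  moreover have "0 \<le> t x \<and> t x < l" for x
    using assms(1) Arg2pi_ge_0[of x] Arg2pi_lt_2pi[of x] by (simp add: t_def field_simps)
  ultimately show ?thesis
    using cyclic_form_lower_bound[OF assms(1,2), of t v] by (simp cong: sum.cong)
qed

lemma finite_magnitude_circle_le:
  assumes "l > 0" "finite W" "W \<subseteq> circle l"
  shows "finite_magnitude W (arc_dist l) \<le> (l / 2) / (1 - exp (- (l / 2)))"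
proof -
  define c where "c = 2 * (1 - exp (- (l / 2))) / l"
  have "c > 0" using assms(1) by (simp add: c_def)
  note form = circle_form_lower_bound[OF assms, folded c_def]
  have nonneg: "0 \<le> c * (sum v W)\<^sup>2" for v :: "complex \<Rightarrow> real"
    using \<open>c > 0\<close> by simp
  \<comment> \<open>\<open>finite_magnitude\<close> is a definite description, so a weighting has to
    be produced before it can be bounded.\<close>
  have "\<exists>w. \<forall>x\<in>W. (\<Sum>y\<in>W. exp (- arc_dist l x y) * w y) = 1"
  proof (rule psd_system_solvable[OF assms(2)])
    show "exp (- arc_dist l x y) = exp (- arc_dist l y x)" for x y
      by (simp add: arc_dist_commute)
    show "0 \<le> (\<Sum>x\<in>W. v x * (\<Sum>y\<in>W. exp (- arc_dist l x y) * v y))" for v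
      using nonneg form by (rule order_trans)
    \<comment> \<open>A null vector of the form satisfies
      \<open>c * (sum v W)\<^sup>2 \<le> 0\<close>, hence sums to zero.\<close>
    show "(\<Sum>x\<in>W. 1 * v x) = 0"
      if "(\<Sum>x\<in>W. v x * (\<Sum>y\<in>W. exp (- arc_dist l x y) * v y)) = 0" for v
      using form[of v] \<open>c > 0\<close> that by (simp add: mult_le_0_iff)
  qed
  then obtain w where w: "weighting_on W (arc_dist l) w"
    unfolding weighting_on_def by blast
  have "c * (sum w W)\<^sup>2 \<le> (\<Sum>x\<in>W. w x * (\<Sum>y\<in>W. exp (- arc_dist l x y) * w y))"
    by (rule form)
  also have "\<dots> = sum w W"
    using w by (simp add: weighting_on_def)
  finally have le: "c * (sum w W)\<^sup>2 \<le> sum w W" .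
  then have "sum w W \<ge> 0" using nonneg[of w] by linarith
  then have "c * sum w W \<le> 1"
    using le by (cases "sum w W = 0") (auto simp: power2_eq_square mult.assoc[symmetric])
  then have "sum w W \<le> 1 / c"
    using \<open>c > 0\<close> by (simp add: field_simps)
  also have "1 / c = (l / 2) / (1 - exp (- (l / 2)))"
    by (simp add: c_def)
  finally show ?thesis
    using finite_magnitude_eq[OF w] arc_dist_commute by metis
qed

section \<open>Magnitude of regular polygons\<close>

text \<open>All rows of a symmetric circulant matrix have the same sum. By the symmetry of
  \<open>f\<close>, the indices \<open>j < i\<close> contribute the values of \<open>f\<close> on
  \<open>{N - i..<N}\<close>, and the remaining ones those on \<open>{0..<N - i}\<close>.\<close>

lemma sum_cyclic_shift:
  fixes f :: "nat \<Rightarrow> real"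
  assumes "i \<le> N" and sym: "\<And>k. k \<le> N \<Longrightarrow> f (N - k) = f k"
  shows "(\<Sum>j<N. f (if j \<le> i then i - j else j - i)) = sum f {..<N}"
proof -
  let ?g = "\<lambda>j. f (if j \<le> i then i - j else j - i)"
  have "sum ?g {..<N} = sum ?g {0..<i} + sum ?g {i..<N}"
    using sum.atLeastLessThan_concat[OF le0 assms(1), of ?g, symmetric]
    unfolding atLeast0LessThan .
  also have "sum ?g {0..<i} = (\<Sum>j\<in>{0..<i}. f (j + (N - i)))"
  proof (intro sum.cong refl)
    fix j assume "j \<in> {0..<i}"
    then show "?g j = f (j + (N - i))"
      using assms(1) sym[of "i - j"] by (simp add: algebra_simps)
  qed
  also have "\<dots> = sum f {N - i..<N}"
    using assms(1) sum.shift_bounds_nat_ivl[of f 0 "N - i" i] by simp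
  also have "sum ?g {i..<N} = sum ?g {0 + i..<(N - i) + i}"
    using assms(1) by simp
  also have "\<dots> = sum f {0..<N - i}"
    unfolding sum.shift_bounds_nat_ivl by (intro sum.cong) auto
  finally show ?thesis
    using sum.atLeastLessThan_concat[of 0 "N - i" N f] by (simp add: atLeast0LessThan add.commute)
qed

lemma sum_exp_cyclic:
  fixes h :: real
  assumes "h > 0"
  shows "(\<Sum>k<2 * m. exp (- (h * min (real k) (real (2 * m) - real k))))
    = (1 + exp (- h)) * (1 - exp (- (h * m))) / (1 - exp (- h))"
proof -
  let ?f = "\<lambda>k. exp (- (h * min (real k) (real (2 * m) - real k)))"
  have "sum ?f {..<2 * m} = sum ?f {0..<m} + sum ?f {0 + m..<m + m}"
    using sum.atLeastLessThan_concat[of 0 m "2 * m" ?f, symmetric]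
    by (simp only: atLeast0LessThan mult_2 add_0)
  also have "sum ?f {0..<m} = (\<Sum>k<m. exp (- h) ^ k)"
    unfolding atLeast0LessThan
    by (intro sum.cong) (auto simp: min_def exp_of_nat_mult[symmetric] mult.commute)
  also have "sum ?f {0 + m..<m + m} = (\<Sum>k<m. exp (- (h * (real m - real k))))"
    unfolding sum.shift_bounds_nat_ivl atLeast0LessThan by (intro sum.cong) (auto simp: min_def)
  \<comment> \<open>The second half runs through the step distances \<open>m\<close> down to 1.
    Reversed, it is the first half, with distances 0 to \<open>m - 1\<close>, multiplied by
    \<open>exp (- h)\<close>.\<close>
  also have "\<dots> = (\<Sum>k<m. exp (- (h * (real m - real (m - Suc k)))))"
    by (rule sum.nat_diff_reindex[symmetric])
  also have "\<dots> = (\<Sum>k<m. exp (- h) * exp (- h) ^ k)"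
    by (intro sum.cong)
       (auto simp: of_nat_diff exp_of_nat_mult[symmetric] exp_add[symmetric] algebra_simps)
  also have "(\<Sum>k<m. exp (- h) ^ k) + \<dots> = (1 + exp (- h)) * (\<Sum>k<m. exp (- h) ^ k)"
    by (simp add: sum_distrib_left distrib_right sum.distrib)
  also have "(\<Sum>k<m. exp (- h) ^ k) = (1 - exp (- (h * m))) / (1 - exp (- h))"
    unfolding sum_gp_strict using assms by (simp add: exp_of_nat_mult[symmetric] mult.commute)
  finally show ?thesis by simp
qed

text \<open>Every row of the similarity matrix has the same sum \<open>S\<close>, so the constant
  \<open>1 / S\<close> is a weighting and the magnitude is the number of vertices divided by
  \<open>S\<close>.\<close>

lemma finite_magnitude_regular_polygon:
  fixes l :: real and m :: nat
  assumes "l > 0" "m > 0"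
  defines "h \<equiv> l / real (2 * m)"
  defines "W \<equiv> (\<lambda>k. rcis (l / (2 * pi)) (2 * pi * real k / real (2 * m))) ` {..<2 * m}"
  shows "finite_magnitude W (arc_dist l)
    = real (2 * m) * (1 - exp (- h)) / ((1 + exp (- h)) * (1 - exp (- (l / 2))))"
proof -
  define N where "N = 2 * m"
  define p where "p k = rcis (l / (2 * pi)) (2 * pi * real k / real N)" for k
  define f where "f k = exp (- (h * min (real k) (real N - real k)))" for k
  have "N > 0" "h > 0" "h * m = l / 2" "h * N = l"
    using assms by (auto simp: N_def h_def)
  have dist: "exp (- arc_dist l (p i) (p j)) = f (if j \<le> i then i - j else j - i)"
    if "i < N" "j < N" for i j
  proof -
    have "arc_dist l (p i) (p j) = cyclic_dist l (h * i) (h * j)"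
      using that assms(1) \<open>N > 0\<close> unfolding p_def h_def N_def[symmetric]
      by (subst arc_dist_rcis_cyclic) (auto simp: field_simps)
    also have "\<dots> = h * min \<bar>real i - real j\<bar> (real N - \<bar>real i - real j\<bar>)"
      using \<open>h > 0\<close> \<open>h * N = l\<close> unfolding cyclic_dist_def
      by (simp add: min_mult_distrib_left right_diff_distrib[symmetric] abs_mult)
         (simp add: right_diff_distrib)
    finally show ?thesis by (auto simp: f_def of_nat_diff)
  qed
  have inj: "inj_on p {..<N}"
  proof (rule inj_onI, rule ccontr)
    fix i j assume ij: "i \<in> {..<N}" "j \<in> {..<N}" "p i = p j" "i \<noteq> j"
    \<comment> \<open>Coinciding points would have the same similarity to \<open>p i\<close>, but
      \<open>f\<close> is 1 at 0 and less than 1 strictly between 0 and \<open>N\<close>.\<close>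
    then have "f (if j \<le> i then i - j else j - i) = f (if i \<le> i then i - i else i - i)"
      using dist[of i j] dist[of i i] by simp
    then show False
      using ij \<open>h > 0\<close> by (auto simp: f_def min_def split: if_splits)
  qed
  define S where "S = sum f {..<N}"
  have "S = (1 + exp (- h)) * (1 - exp (- (l / 2))) / (1 - exp (- h))"
    using sum_exp_cyclic[OF \<open>h > 0\<close>, of m] by (simp add: S_def f_def N_def \<open>h * m = l / 2\<close>)
  then have "S \<noteq> 0" and inv: "real N * (1 / S)
      = real N * (1 - exp (- h)) / ((1 + exp (- h)) * (1 - exp (- (l / 2))))"
    using \<open>h > 0\<close> assms(1) by (auto simp: add_pos_pos add_nonneg_eq_0_iff)
  have W: "W = p ` {..<N}" by (simp add: W_def p_def N_def)
  have "(\<Sum>y\<in>W. exp (- arc_dist l (p i) y) * (1 / S)) = 1" if "i < N" for i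
  proof -
    have "(\<Sum>y\<in>W. exp (- arc_dist l (p i) y) * (1 / S))
        = (\<Sum>j<N. f (if j \<le> i then i - j else j - i)) * (1 / S)"
      unfolding W sum.reindex[OF inj] sum_distrib_right using that by (intro sum.cong) (auto simp: dist)
    also have "(\<Sum>j<N. f (if j \<le> i then i - j else j - i)) = S"
      unfolding S_def using that
      by (intro sum_cyclic_shift) (auto simp: f_def of_nat_diff min.commute)
    finally show ?thesis using \<open>S \<noteq> 0\<close> by simp
  qed
  then have "weighting_on W (arc_dist l) (\<lambda>_. 1 / S)"
    by (auto simp: weighting_on_def W)
  then have "finite_magnitude W (arc_dist l) = (\<Sum>x\<in>W. 1 / S)"
    using finite_magnitude_eq arc_dist_commute by metis
  also have "\<dots> = real N * (1 / S)"
    by (simp add: W card_image[OF inj])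
  finally show ?thesis
    using inv by (simp only: N_def)
qed

section \<open>The supremum over finite subsets\<close>

theorem theorem14:
  fixes l :: real
  assumes "l > 0"
  shows "magnitude (circle l) (arc_dist l) = ereal ((l / 2) / (1 - exp (- (l / 2))))"
proof (rule antisym)
  show "magnitude (circle l) (arc_dist l) \<le> ereal ((l / 2) / (1 - exp (- (l / 2))))"
    unfolding magnitude_def using finite_magnitude_circle_le[OF assms] by (auto intro!: SUP_least)
next
  define M where "M m = real (2 * m) * (1 - exp (- (l / real (2 * m))))
      / ((1 + exp (- (l / real (2 * m)))) * (1 - exp (- (l / 2))))" for m :: nat
  \<comment> \<open>The numerator tends to \<open>l\<close>, the derivative of
    \<open>1 - exp (- l * x)\<close> at 0, and the denominator tends to 2.\<close>
  have "(\<lambda>m. real (2 * m) * (1 - exp (- (l / real (2 * m)))) / (1 + exp (- (l / real (2 * m)))))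
      \<longlonglongrightarrow> l / 2"
    using assms by real_asymp
  then have "(\<lambda>m. real (2 * m) * (1 - exp (- (l / real (2 * m)))) / (1 + exp (- (l / real (2 * m))))
      / (1 - exp (- (l / 2)))) \<longlonglongrightarrow> (l / 2) / (1 - exp (- (l / 2)))"
    by (rule tendsto_divide[OF _ tendsto_const]) (use assms in simp)
  then have "(\<lambda>m. ereal (M m)) \<longlonglongrightarrow> ereal ((l / 2) / (1 - exp (- (l / 2))))"
    by (simp add: M_def)
  moreover have "ereal (M m) \<le> magnitude (circle l) (arc_dist l)" if "m > 0" for m
  proof -
    let ?W = "(\<lambda>k. rcis (l / (2 * pi)) (2 * pi * real k / real (2 * m))) ` {..<2 * m}"
    have "?W \<subseteq> circle l"
      using assms by (auto simp: circle_def)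
    then have "ereal (finite_magnitude ?W (arc_dist l)) \<le> magnitude (circle l) (arc_dist l)"
      unfolding magnitude_def by (intro SUP_upper) auto
    then show ?thesis
      unfolding finite_magnitude_regular_polygon[OF assms that] M_def .
  qed
  then have "\<forall>\<^sub>F m in sequentially. ereal (M m) \<le> magnitude (circle l) (arc_dist l)"
    by (intro eventually_sequentiallyI[of 1]) auto
  ultimately show "ereal ((l / 2) / (1 - exp (- (l / 2)))) \<le> magnitude (circle l) (arc_dist l)"
    by (intro tendsto_upperbound) auto
qed

end
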